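(* Let $C\subset\mathbb E^d$ be compact, convex, symmetric in the origin $o$, and with $B^d\subset C$. Then the following claims are equivalent: (i) $B^d$ is the unique ellipsoid of maximum volume in $C$. (ii) There are $u_k\in B^d\cap \operatorname{bd} C$ and real numbers $\lambda_k>0$, $k=1,\dots,n$, where $d\le n\le \frac12 d(d+1)$, such that $$I=\sum_{k=1}^n \lambda_k\, u_k\otimes u_k.$$
   Context: $\mathbb E^d$ is Euclidean $d$-space, with origin $o$. $B^d$ is the solid (closed) unit ball of $\mathbb E^d$ centered at $o$. $I$ is the $d\times d$ unit (identity) matrix. For $u,v\in\mathbb E^d$ (column vectors), $u\otimes v$ denotes the $d\times d$ matrix $u\,v^T$. $\operatorname{bd} C$ is the boundary of $C$. An ellipsoid in $\mathbb E^d$ is a (solid, non-degenerate) set of the form $AB^d+a$ with $A$ a symmetric positive definite $d\times d$ matrix and $a\in\mathbb E^d$; "symmetric in $o$" means $C=-C$. *)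

theory Defs
  imports "HOL-Analysis.Analysis"
begin

definition outer_prod :: "real ^ 'd \<Rightarrow> real ^ 'd \<Rightarrow> real ^ 'd ^ 'd"
  where "outer_prod u v = (columnvector u :: real ^ 1 ^ 'd) ** (rowvector v :: real ^ 'd ^ 1)"

lemma outer_prod_nth: "outer_prod u v $ i $ j = u $ i * v $ j"
  by (simp add: outer_prod_def matrix_matrix_mult_def columnvector_def rowvector_def)

definition sym_pos_def :: "real ^ 'd ^ 'd \<Rightarrow> bool"
  where "sym_pos_def A \<longleftrightarrow> transpose A = A \<and> (\<forall>x. x \<noteq> 0 \<longrightarrow> x \<bullet> (A *v x) > 0)"

text \<open>The centre is arbitrary, so an ellipsoid contained in a symmetric body need not be
  symmetric itself.\<close>

definition ellipsoid :: "(real ^ 'd) set \<Rightarrow> bool"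
  where "ellipsoid E \<longleftrightarrow>
    (\<exists>A a. sym_pos_def A \<and> E = (\<lambda>x. A *v x + a) ` cball 0 1)"

definition max_volume_ellipsoid_in :: "(real ^ 'd) set \<Rightarrow> (real ^ 'd) set \<Rightarrow> bool"
  where "max_volume_ellipsoid_in C E \<longleftrightarrow>
    ellipsoid E \<and> E \<subseteq> C \<and>
    (\<forall>F. ellipsoid F \<and> F \<subseteq> C \<longrightarrow> measure lebesgue F \<le> measure lebesgue E)"

definition unique_max_volume_ellipsoid_in :: "(real ^ 'd) set \<Rightarrow> (real ^ 'd) set \<Rightarrow> bool"
  where "unique_max_volume_ellipsoid_in C E \<longleftrightarrow>
    max_volume_ellipsoid_in C E \<and> (\<forall>F. max_volume_ellipsoid_in C F \<longrightarrow> F = E)"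

end

theory Submission
  imports Defs
begin

text \<open>
  If \<open>I = \<Sum> \<lambda>\<^sub>k u\<^sub>k \<otimes> u\<^sub>k\<close> and \<open>A B + a \<subseteq> C\<close>, the supporting hyperplanes of \<open>C\<close> at the contact
  points \<open>\<plusminus>u\<^sub>k\<close> give \<open>u\<^sub>k \<bullet> A u\<^sub>k + \<bar>a \<bullet> u\<^sub>k\<bar> \<le> 1\<close>; summing with weights \<open>\<lambda>\<^sub>k\<close> yields \<open>tr A \<le> d\<close>, hence
  \<open>det A < 1\<close> unless \<open>A = I\<close>, and in that case \<open>a = 0\<close>.

  Conversely, if \<open>I / d\<close> is not in the convex hull of the matrices \<open>u \<otimes> u\<close> with \<open>u\<close> a contact point,
  a separating hyperplane in the space of matrices is a symmetric \<open>N\<close> with \<open>tr N < 0\<close> and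
  \<open>u \<bullet> N u > 0\<close> at all contact points, and for small \<open>t > 0\<close> the ellipsoid \<open>(I - t N) B\<close> lies in \<open>C\<close> and
  has larger volume than \<open>B\<close>. The bound on the number of points is Caratheodory's theorem in the
  hyperplane of symmetric matrices of trace 1.
\<close>

section \<open>Volumes of linear images\<close>

text \<open>For a linear map it suffices to compare volumes on boxes. A swap sends a nonempty box to
  the box with permuted sides, so the products of side lengths agree.\<close>

lemma measure_swap_coordinates:
  fixes S :: "(real ^ 'n) set"
  assumes "S \<in> lmeasurable"
  shows "measure lebesgue ((\<lambda>x. \<chi> i. x $ Transposition.transpose m n i) ` S) = measure lebesgue S"
proof -
  let ?\<tau> = "Transposition.transpose m n"
  let ?f = "\<lambda>x :: real ^ 'n. \<chi> i. x $ ?\<tau> i"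
  have lin: "linear ?f"
    by (rule linearI) (simp_all add: vec_eq_iff)
  have box: "measure lebesgue (?f ` cbox a b) = 1 * measure lebesgue (cbox a b)" for a b
  proof (cases "cbox a b = {}")
    case False
    have image: "?f ` cbox a b = cbox (?f a) (?f b)"
    proof (intro equalityI subsetI)
      fix x assume "x \<in> cbox (?f a) (?f b)"
      then have "a $ i \<le> ?f x $ i \<and> ?f x $ i \<le> b $ i" for i
        by (auto simp: mem_box_cart dest: spec[of _ "?\<tau> i"])
      then have "?f x \<in> cbox a b" by (simp add: mem_box_cart)
      moreover have "x = ?f (?f x)" by (simp add: vec_eq_iff)
      ultimately show "x \<in> ?f ` cbox a b" by blast
    qed (auto simp: mem_box_cart)
    then have "cbox (?f a) (?f b) \<noteq> {}"
      using False by auto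
    moreover have "(\<Prod>i\<in>UNIV. b $ ?\<tau> i - a $ ?\<tau> i) = (\<Prod>i\<in>UNIV. b $ i - a $ i)"
      by (rule prod.reindex_bij_witness[of _ ?\<tau> ?\<tau>]) auto
    ultimately show ?thesis
      using False unfolding image by (simp add: content_cbox_cart)
  qed simp
  show ?thesis
    using measure_linear_sufficient[OF lin assms box] by simp
qed

lemma measure_shear:
  fixes S :: "(real ^ 'n) set"
  assumes "m \<noteq> n" "S \<in> lmeasurable"
  shows "measure lebesgue ((\<lambda>x. \<chi> i. if i = m then x $ m + x $ n else x $ i) ` S) = measure lebesgue S"
proof -
  let ?f = "\<lambda>x :: real ^ 'n. \<chi> i. if i = m then x $ m + x $ n else x $ i"
  have lin: "linear ?f"
    by (rule linearI) (auto simp: vec_eq_iff algebra_simps)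
  have box: "measure lebesgue (?f ` cbox a b) = 1 * measure lebesgue (cbox a b)" for a b
  proof (cases "cbox a b = {}")
    case False
    \<comment> \<open>\<open>measure_shear_interval\<close> needs a nonnegative lower bound in
      coordinate \<open>n\<close>; translating by \<open>c\<close> makes that bound 0.\<close>
    define c where "c = axis n (a $ n)"
    have shift: "cbox a b = (+) c ` cbox (a - c) (b - c)"
      by (simp flip: cbox_translation)
    then have "?f ` cbox a b = (+) (?f c) ` ?f ` cbox (a - c) (b - c)"
      by (simp add: image_image linear_add[OF lin])
    then have "measure lebesgue (?f ` cbox a b) = measure lebesgue (?f ` cbox (a - c) (b - c))"
      by (simp only: measure_translation)
    also have "\<dots> = measure lebesgue (cbox (a - c) (b - c))"
      using False shift assms(1) by (intro measure_shear_interval) (auto simp: c_def)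
    also have "\<dots> = measure lebesgue (cbox a b)"
      unfolding shift by (simp only: measure_translation)
    finally show ?thesis by simp
  qed simp
  show ?thesis
    using measure_linear_sufficient[OF lin assms(2) box] by simp
qed


text \<open>The library fact \<open>measure_linear_image\<close> requires a well-ordered index type.\<close>

lemma measure_linear_image_compact:
  fixes f :: "real ^ 'n \<Rightarrow> real ^ 'n"
  assumes "linear f" "compact S"
  shows "measure lebesgue (f ` S) = \<bar>det (matrix f)\<bar> * measure lebesgue S"
proof -
  \<comment> \<open>Quantifying over all compact sets lets the composition case apply the hypothesis
    for \<open>f\<close> to the compact image of \<open>S\<close> under \<open>g\<close>.\<close>
  define P :: "(real ^ 'n \<Rightarrow> real ^ 'n) \<Rightarrow> bool" where
    "P f \<longleftrightarrow> (\<forall>S. compact S \<longrightarrow> measure lebesgue (f ` S) = \<bar>det (matrix f)\<bar> * measure lebesgue S)" for f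
  have "P f"
  proof (rule induct_linear_elementary[OF assms(1), of P])
    fix f g :: "real ^ 'n \<Rightarrow> real ^ 'n"
    assume lin: "linear f" "linear g" and "P f" "P g"
    moreover have "compact (g ` S)" if "compact S" for S
      using that lin(2) by (simp add: compact_continuous_image linear_continuous_on linear_conv_bounded_linear)
    ultimately show "P (f \<circ> g)"
      unfolding P_def image_comp[symmetric] by (simp add: matrix_compose det_mul abs_mult)
  next
    fix f :: "real ^ 'n \<Rightarrow> real ^ 'n" and i
    assume f: "linear f" "\<And>x. f x $ i = 0"
    then have "\<not> surj f"
      by (metis surjD vec_component zero_neq_one)
    then have "\<not> inj f"
      using f(1) linear_injective_imp_surjective by blast
    then have "det (matrix f) = 0" "negligible (f ` S)" for S
      using f(1) det_nz_iff_inj negligible_linear_singular_image by blast+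
    then show "P f"
      by (simp add: P_def negligible_imp_measure0)
  next
    fix c :: "'n \<Rightarrow> real"
    have "matrix (\<lambda>x. \<chi> i. c i * x $ i) = (\<chi> i j. if i = j then c i else 0)"
      by (simp add: vec_eq_iff matrix_def axis_def)
    then show "P (\<lambda>x. \<chi> i. c i * x $ i)"
      by (simp add: P_def measure_stretch lmeasurable_compact det_diagonal)
  next
    fix m n :: 'n
    let ?f = "\<lambda>x :: real ^ 'n. \<chi> i. x $ Transposition.transpose m n i"
    have "matrix ?f = (\<chi> i. mat 1 $ Transposition.transpose m n i)"
      by (simp add: vec_eq_iff matrix_def axis_def mat_def)
    then have "\<bar>det (matrix ?f)\<bar> = 1"
      by (simp add: det_permute_rows permutes_swap_id sign_swap_id)
    then show "P ?f"
      by (simp add: P_def measure_swap_coordinates lmeasurable_compact)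
  next
    fix m n :: 'n assume "m \<noteq> n"
    let ?f = "\<lambda>x :: real ^ 'n. \<chi> i. if i = m then x $ m + x $ n else x $ i"
    have "matrix ?f = (\<chi> i. if i = m then row m (mat 1) + 1 *s row n (mat 1) else row i (mat 1))"
      by (simp add: vec_eq_iff matrix_def axis_def mat_def row_def)
    then have "det (matrix ?f) = 1"
      using det_row_operation[OF \<open>m \<noteq> n\<close>, of "mat 1 :: real ^ 'n ^ 'n" 1] by simp
    then show "P ?f"
      using \<open>m \<noteq> n\<close> by (simp add: P_def measure_shear lmeasurable_compact)
  qed
  with assms(2) show ?thesis by (simp add: P_def)
qed

section \<open>Determinants of positive definite matrices\<close>

lemma transpose_eq_imp_inner_matrix_vector:
  fixes A :: "real ^ 'n ^ 'n"
  assumes "transpose A = A"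
  shows "(A *v x) \<bullet> y = x \<bullet> (A *v y)"
  using assms by (metis dot_lmul_matrix vector_transpose_matrix)

lemma trace_eq_sum_inner: "trace A = (\<Sum>i\<in>UNIV. axis i 1 \<bullet> (A *v axis i 1))"
  for A :: "real ^ 'n ^ 'n"
  by (simp add: trace_def matrix_vector_mult_basis inner_axis' column_def)

lemma trace_scaleR: "trace (c *\<^sub>R A) = c * trace A" for A :: "real ^ 'n ^ 'n"
  by (simp add: trace_def sum_distrib_left)

lemma inner_mat_1: "A \<bullet> mat 1 = trace A" for A :: "real ^ 'n ^ 'n"
  by (simp add: inner_vec_def trace_def mat_def if_distrib cong: if_cong)

lemma trace_outer_prod: "trace (outer_prod u v) = u \<bullet> v"
  by (simp add: trace_def outer_prod_nth inner_vec_def)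

text \<open>Linear functionals on matrices thus restrict to quadratic forms on the rank-one matrices
  \<open>outer_prod u u\<close>, which turns separation of matrices into inequalities at contact
  points.\<close>

lemma inner_outer_prod: "A \<bullet> outer_prod u v = u \<bullet> (A *v v)"
  by (simp add: inner_vec_def outer_prod_nth matrix_vector_mult_def sum_distrib_left mult_ac)

lemma outer_prod_vector_mult: "outer_prod u v *v x = (v \<bullet> x) *\<^sub>R u"
  by (simp add: vec_eq_iff matrix_vector_mult_def outer_prod_nth inner_vec_def
      sum_distrib_left sum_distrib_right mult_ac)

text \<open>Differentiate the Leibniz expansion term by term; only the identity permutation
  contributes at 0.\<close>

lemma has_real_derivative_det_mat_1:
  fixes M :: "real ^ 'n ^ 'n"
  shows "((\<lambda>t. det (mat 1 + t *\<^sub>R M)) has_real_derivative trace M) (at 0)"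
proof -
  define c where "c p i = (if i = p i then 1 else 0 :: real)" for p and i :: 'n
  \<comment> \<open>A permutation other than \<open>id\<close> moves at least the two indices
    \<open>j\<close> and \<open>p j\<close>, so removing one factor still leaves a vanishing
    one.\<close>
  have other: "(\<Prod>j\<in>UNIV - {i}. c p j) = 0" if p: "p permutes UNIV" "p \<noteq> id" for p i
  proof -
    obtain j where j: "p j \<noteq> j"
      using p(2) by (auto simp: fun_eq_iff)
    have "p (p j) \<noteq> p j"
      using j permutes_inj[OF p(1)] by (auto dest: injD)
    then have "c p j = 0" "c p (p j) = 0"
      using j by (auto simp: c_def)
    moreover have "j \<noteq> i \<or> p j \<noteq> i"
      using j by auto
    ultimately show ?thesis
      by (auto simp: prod_zero_iff)
  qed
  have "((\<lambda>t. \<Sum>p | p permutes UNIV. of_int (sign p) * (\<Prod>i\<in>UNIV. c p i + t * M $ i $ p i))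
      has_real_derivative
        (\<Sum>p | p permutes UNIV. of_int (sign p) *
          (\<Sum>i\<in>UNIV. M $ i $ p i * (\<Prod>j\<in>UNIV - {i}. c p j + 0 * M $ j $ p j)))) (at 0)"
    by (intro DERIV_sum DERIV_cmult has_field_derivative_prod) (auto intro!: derivative_eq_intros)
  also have "(\<lambda>t. \<Sum>p | p permutes UNIV. of_int (sign p) * (\<Prod>i\<in>UNIV. c p i + t * M $ i $ p i))
      = (\<lambda>t. det (mat 1 + t *\<^sub>R M))"
    by (simp add: det_def mat_def c_def)
  also have "(\<Sum>p | p permutes UNIV. of_int (sign p) *
          (\<Sum>i\<in>UNIV. M $ i $ p i * (\<Prod>j\<in>UNIV - {i}. c p j + 0 * M $ j $ p j)))
      = (\<Sum>p | p permutes (UNIV :: 'n set). if p = id then trace M else 0)"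
  proof (rule sum.cong[OF refl])
    fix p :: "'n \<Rightarrow> 'n" assume "p \<in> {p. p permutes UNIV}"
    then show "of_int (sign p) *
        (\<Sum>i\<in>UNIV. M $ i $ p i * (\<Prod>j\<in>UNIV - {i}. c p j + 0 * M $ j $ p j))
        = (if p = id then trace M else 0)"
      by (cases "p = id") (simp_all add: other, simp add: c_def trace_def)
  qed
  also have "\<dots> = trace M"
    by (simp add: permutes_id[unfolded id_def] permutes_id)
  finally show ?thesis .
qed

text \<open>Jacobi's formula, reduced to the derivative at the identity by factoring
  \<open>S + h M = S (I + h B M)\<close>.\<close>

lemma has_real_derivative_det:
  fixes S B M :: "real ^ 'n ^ 'n"
  assumes "S ** B = mat 1"
  shows "((\<lambda>h. det (S + h *\<^sub>R M)) has_real_derivative det S * trace (B ** M)) (at 0)"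
proof -
  have "S ** (mat 1 + h *\<^sub>R (B ** M)) = S + h *\<^sub>R M" for h
  proof -
    have "S ** (h *\<^sub>R (B ** M)) = h *\<^sub>R ((S ** B) ** M)"
      by (simp add: matrix_scalar_ac matrix_mul_assoc scalar_matrix_assoc flip: scalar_matrix_assoc)
    then show ?thesis
      by (simp add: matrix_add_ldistrib assms)
  qed
  then have "(\<lambda>h. det (S + h *\<^sub>R M)) = (\<lambda>h. det S * det (mat 1 + h *\<^sub>R (B ** M)))"
    by (metis det_mul)
  then show ?thesis
    by (simp add: DERIV_cmult has_real_derivative_det_mat_1)
qed

lemma sym_pos_def_imp_invertible: "invertible A" if "sym_pos_def A"
proof -
  have "inj ((*v) A)"
  proof (rule injI)
    fix x y assume "A *v x = A *v y"
    then have "(x - y) \<bullet> (A *v (x - y)) = 0"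
      by (simp add: matrix_vector_mult_diff_distrib)
    then show "x = y"
      using that unfolding sym_pos_def_def by (metis less_irrefl right_minus_eq)
  qed
  then show ?thesis
    by (simp add: invertible_left_inverse matrix_left_invertible_injective)
qed

text \<open>With \<open>B = S\<^sup>-\<^sup>1\<close>, the quadratic form of \<open>S\<close> at \<open>x - B x\<close> is that of \<open>S + B - 2 I\<close> at \<open>x\<close>.\<close>

lemma trace_add_trace_inverse_gt:
  fixes S B :: "real ^ 'n ^ 'n"
  assumes S: "sym_pos_def S" and SB: "S ** B = mat 1" and "S \<noteq> mat 1"
  shows "2 * real CARD('n) < trace S + trace B"
proof -
  let ?e = "\<lambda>i. axis i 1 :: real ^ 'n"
  have form: "(x - B *v x) \<bullet> (S *v (x - B *v x)) = x \<bullet> (S *v x) + x \<bullet> (B *v x) - 2 * (x \<bullet> x)" for x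
  proof -
    have SBx: "S *v (B *v x) = x"
      by (simp add: matrix_vector_mul_assoc SB)
    have "(B *v x) \<bullet> (S *v x) = x \<bullet> x"
      using transpose_eq_imp_inner_matrix_vector[of S "B *v x" x] S
      by (simp add: SBx sym_pos_def_def)
    then show ?thesis
      by (simp add: matrix_vector_mult_diff_distrib SBx inner_diff inner_commute algebra_simps)
  qed
  have nonneg: "0 \<le> y \<bullet> (S *v y)" for y
    using S unfolding sym_pos_def_def by (cases "y = 0") (auto intro: less_imp_le)
  have "\<exists>i. ?e i - B *v ?e i \<noteq> 0"
  proof (rule ccontr)
    assume "\<not> ?thesis"
    then have "B *v ?e i = ?e i" for i by simp
    then have "column i B = ?e i" for i
      by (simp add: matrix_vector_mult_basis)
    then have "B = mat 1"
      by (simp add: vec_eq_iff column_def axis_def mat_def)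
    with SB \<open>S \<noteq> mat 1\<close> show False by simp
  qed
  then have "0 < (\<Sum>i\<in>UNIV. (?e i - B *v ?e i) \<bullet> (S *v (?e i - B *v ?e i)))"
    using S nonneg unfolding sym_pos_def_def by (metis (no_types, lifting) UNIV_I finite sum_pos2)
  also have "\<dots> = trace S + trace B - 2 * real CARD('n)"
    unfolding form by (simp add: trace_eq_sum_inner sum.distrib sum_subtractf inner_axis_axis)
  finally show ?thesis by simp
qed

lemma sym_pos_def_segment:
  fixes A :: "real ^ 'n ^ 'n"
  assumes "sym_pos_def A" "0 \<le> t" "t \<le> 1"
  shows "sym_pos_def (mat 1 + t *\<^sub>R (A - mat 1))"
  unfolding sym_pos_def_def
proof (intro conjI allI impI)
  show "transpose (mat 1 + t *\<^sub>R (A - mat 1)) = mat 1 + t *\<^sub>R (A - mat 1)"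
    using assms by (simp add: sym_pos_def_def vec_eq_iff transpose_def mat_def)
  fix x :: "real ^ 'n" assume "x \<noteq> 0"
  have "x \<bullet> ((mat 1 + t *\<^sub>R (A - mat 1)) *v x) = (1 - t) * (x \<bullet> x) + t * (x \<bullet> (A *v x))"
    by (simp add: algebra_simps inner_add inner_diff flip: scaleR_matrix_vector_assoc)
  also have "\<dots> > 0"
  proof (cases "t = 1")
    case False
    then have "0 < (1 - t) * (x \<bullet> x)"
      using assms \<open>x \<noteq> 0\<close> by simp
    moreover have "0 \<le> t * (x \<bullet> (A *v x))"
      using assms \<open>x \<noteq> 0\<close> by (simp add: sym_pos_def_def less_imp_le)
    ultimately show ?thesis
      by (rule add_pos_nonneg)
  qed (use assms \<open>x \<noteq> 0\<close> in \<open>auto simp: sym_pos_def_def\<close>)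
  finally show "0 < x \<bullet> ((mat 1 + t *\<^sub>R (A - mat 1)) *v x)" .
qed

lemma has_real_derivative_det_line:
  fixes S M B :: "real ^ 'n ^ 'n"
  assumes "(S + t *\<^sub>R M) ** B = mat 1"
  shows "((\<lambda>t. det (S + t *\<^sub>R M)) has_real_derivative
    det (S + t *\<^sub>R M) * trace (B ** M)) (at t)"
proof -
  have "((\<lambda>h. det (S + (t + h) *\<^sub>R M)) has_real_derivative
      det (S + t *\<^sub>R M) * trace (B ** M)) (at 0)"
    using has_real_derivative_det[OF assms, of M] by (simp add: algebra_simps)
  then show ?thesis
    using DERIV_shift[of "\<lambda>t. det (S + t *\<^sub>R M)" _ 0 t] by (simp add: add.commute)
qed

lemma sym_pos_def_obtain_inverse:
  fixes A :: "real ^ 'n ^ 'n"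
  assumes "sym_pos_def A"
  obtains B where "A ** B = mat 1" "B ** A = mat 1"
  using sym_pos_def_imp_invertible[OF assms] unfolding invertible_def by blast

text \<open>The segment from the identity to \<open>A\<close> consists of invertible matrices, so
  the determinant, which is continuous and starts at 1, cannot reach a nonpositive value without
  crossing zero.\<close>

lemma sym_pos_def_imp_det_pos:
  fixes A :: "real ^ 'n ^ 'n"
  assumes "sym_pos_def A"
  shows "0 < det A"
proof (rule ccontr)
  define f where "f t = det (mat 1 + t *\<^sub>R (A - mat 1))" for t
  assume "\<not> 0 < det A"
  moreover have "\<exists>y. DERIV f t :> y" if "0 \<le> t" "t \<le> 1" for t
    using sym_pos_def_obtain_inverse[OF sym_pos_def_segment[OF assms that]]
      has_real_derivative_det_line unfolding f_def by metis
  ultimately have "\<exists>t\<ge>0. t \<le> 1 \<and> f t = 0"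
    by (intro IVT2) (auto intro: DERIV_isCont, simp_all add: f_def)
  then show False
    using sym_pos_def_segment[OF assms] sym_pos_def_imp_invertible
    unfolding f_def by (metis invertible_det_nz)
qed

text \<open>\<open>det\<close> is strictly decreasing on the segment from \<open>I\<close> to \<open>A\<close>: at \<open>S = I + t (A - I)\<close> its derivative
  is \<open>det S (d - tr S\<^sup>-\<^sup>1) / t\<close>, and \<open>tr S\<^sup>-\<^sup>1 > 2 d - tr S \<ge> d\<close>.\<close>

lemma det_less_one:
  fixes A :: "real ^ 'n ^ 'n"
  assumes A: "sym_pos_def A" and tr: "trace A \<le> real CARD('n)" and "A \<noteq> mat 1"
  shows "det A < 1"
proof -
  define S where "S t = mat 1 + t *\<^sub>R (A - mat 1)" for t
  \<comment> \<open>Strictness is claimed only for \<open>0 < t\<close>: at \<open>t = 0\<close> the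
    derivative is \<open>tr A - d\<close>, which may vanish. Negativity on the open interval
    suffices for strict decrease.\<close>
  have deriv: "\<exists>y. ((\<lambda>t. det (S t)) has_real_derivative y) (at t) \<and> (0 < t \<longrightarrow> y < 0)"
    if t: "0 \<le> t" "t \<le> 1" for t
  proof -
    have St: "sym_pos_def (S t)"
      using A t unfolding S_def by (rule sym_pos_def_segment)
    then obtain B where B: "S t ** B = mat 1" "B ** S t = mat 1"
      by (rule sym_pos_def_obtain_inverse)
    have "trace (B ** (A - mat 1)) < 0" if "0 < t"
    proof -
      have "trace (S t) \<le> real CARD('n)"
        using tr t by (simp add: S_def trace_add trace_sub trace_scaleR trace_I mult_nonneg_nonpos)
      moreover have "S t \<noteq> mat 1"
        using \<open>A \<noteq> mat 1\<close> that by (simp add: S_def)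
      ultimately have "real CARD('n) < trace B"
        using trace_add_trace_inverse_gt[OF St B(1)] by simp
      \<comment> \<open>Since \<open>t (A - I) = S t - I\<close>, multiplying by \<open>B\<close> on
        the left gives \<open>I - B\<close>.\<close>
      moreover have "t * trace (B ** (A - mat 1)) = real CARD('n) - trace B"
      proof -
        have "t *\<^sub>R (B ** (A - mat 1)) = B ** (t *\<^sub>R (A - mat 1))"
          by (simp add: matrix_scalar_ac scalar_matrix_assoc)
        also have "\<dots> = mat 1 - B"
          using B(2) by (simp add: S_def matrix_add_ldistrib eq_diff_eq add.commute)
        finally show ?thesis
          by (metis trace_I trace_scaleR trace_sub)
      qed
      ultimately have "t * trace (B ** (A - mat 1)) < 0" by simp
      with that show ?thesis by (simp add: mult_less_0_iff)
    qed
    moreover have "0 < det (S t)"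
      using St by (rule sym_pos_def_imp_det_pos)
    ultimately show ?thesis
      using has_real_derivative_det_line B(1) unfolding S_def by (metis mult_pos_neg)
  qed
  have "det (S 1) < det (S 0)"
  proof (rule DERIV_neg_imp_decreasing_open[where f = "\<lambda>t. det (S t)"])
    show "continuous_on {0..1} (\<lambda>t. det (S t))"
      using deriv by (intro DERIV_atLeastAtMost_imp_continuous_on) auto
  qed (simp, metis deriv less_imp_le)
  then show ?thesis by (simp add: S_def)
qed

section \<open>Contact points and ellipsoids\<close>

lemma measure_ellipsoid:
  fixes A :: "real ^ 'n ^ 'n"
  shows "measure lebesgue ((\<lambda>x. A *v x + a) ` cball 0 1) = \<bar>det A\<bar> * measure lebesgue (cball 0 1 :: (real ^ 'n) set)"
proof -
  have "(\<lambda>x. A *v x + a) ` cball 0 1 = (+) a ` ((*v) A ` cball 0 1)"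
    by (auto simp: image_image add.commute)
  then have "measure lebesgue ((\<lambda>x. A *v x + a) ` cball 0 1) = measure lebesgue ((*v) A ` cball 0 1)"
    by (simp only: measure_translation)
  also have "\<dots> = \<bar>det (matrix ((*v) A))\<bar> * measure lebesgue (cball 0 1 :: (real ^ 'n) set)"
    by (rule measure_linear_image_compact) simp_all
  finally show ?thesis by simp
qed

lemma sym_pos_def_mat_1: "sym_pos_def (mat 1)"
  by (simp add: sym_pos_def_def transpose_mat)

lemma ellipsoid_unit_ball: "ellipsoid (cball 0 1 :: (real ^ 'n) set)"
proof -
  have "cball 0 1 = (\<lambda>x. mat 1 *v x + 0) ` cball (0 :: real ^ 'n) 1" by simp
  with sym_pos_def_mat_1 show ?thesis
    unfolding ellipsoid_def by blast
qed

text \<open>The open unit ball lies in the interior of \<open>C\<close>, so it contains no boundary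
  point.\<close>

lemma norm_contact_point:
  fixes C :: "'a :: euclidean_space set"
  assumes "cball 0 1 \<subseteq> C" "u \<in> cball 0 1 \<inter> frontier C"
  shows "norm u = 1"
proof (rule ccontr)
  assume "norm u \<noteq> 1"
  with assms(2) have "u \<in> ball 0 1" by auto
  moreover have "ball 0 1 \<subseteq> interior C"
    using assms(1) interior_mono interior_cball by blast
  ultimately show False
    using assms(2) by (auto simp: frontier_def)
qed

text \<open>A hyperplane supporting \<open>C\<close> at \<open>u\<close> also supports the unit ball
  there, and the ball has only one supporting hyperplane at \<open>u\<close>, namely the one with
  normal \<open>u\<close>.\<close>

lemma inner_contact_point_le:
  fixes C :: "'a :: euclidean_space set"
  assumes C: "convex C" "cball 0 1 \<subseteq> C" and u: "u \<in> cball 0 1 \<inter> frontier C" and x: "x \<in> C"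
  shows "x \<bullet> u \<le> 1"
proof -
  have nu: "norm u = 1"
    using norm_contact_point[OF C(2) u] .
  have "ball 0 1 \<subseteq> interior C"
    using C(2) interior_mono interior_cball by blast
  then have "rel_interior C = interior C"
    by (intro rel_interior_nonempty_interior) auto
  then have "u \<in> closure C" "u \<notin> rel_interior C"
    using u by (auto simp: frontier_def)
  then obtain a where "a \<noteq> 0" and a: "\<And>y. y \<in> closure C \<Longrightarrow> a \<bullet> u \<le> a \<bullet> y"
    using supporting_hyperplane_relative_frontier[OF C(1)] by metis
  define w where "w = a /\<^sub>R norm a"
  have nw: "norm w = 1"
    using \<open>a \<noteq> 0\<close> by (simp add: w_def)
  have w: "w \<bullet> u \<le> w \<bullet> y" if "y \<in> C" for y
    using a[of y] that closure_subset[of C] by (simp add: w_def mult_left_mono subset_iff)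
  \<comment> \<open>Testing the unit inner normal \<open>w\<close> at the ball point
    \<open>- w\<close> gives the extreme case of Cauchy-Schwarz, hence
    \<open>w = - u\<close>.\<close>
  have "w \<bullet> u \<le> w \<bullet> (- w)"
    using C(2) nw by (intro w) auto
  then have "w \<bullet> u \<le> - 1"
    using nw by (simp add: norm_eq_1)
  moreover have "(norm (w + u))\<^sup>2 = 2 + 2 * (w \<bullet> u)"
    using nw nu by (simp add: power2_norm_eq_inner inner_add norm_eq_1 inner_commute)
  ultimately have "(norm (w + u))\<^sup>2 \<le> 0" by simp
  then have "w = - u"
    by (simp add: eq_neg_iff_add_eq_0)
  with w[OF x] nu show ?thesis
    by (simp add: norm_eq_1 inner_commute)
qed

lemma sum_outer_prod_vector_mult:
  "(\<Sum>k\<in>K. l k *\<^sub>R outer_prod (u k) (u k)) *v x = (\<Sum>k\<in>K. (l k * (u k \<bullet> x)) *\<^sub>R u k)"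
  by (induction K rule: infinite_finite_induct)
    (simp_all add: matrix_vector_mult_add_rdistrib outer_prod_vector_mult flip: scaleR_matrix_vector_assoc)

text \<open>Strict inequality for every ellipsoid other than the ball, whatever its centre, gives
  maximality and uniqueness at once.\<close>

lemma measure_ellipsoid_less_unit_ball:
  fixes C :: "(real ^ 'n) set" and u :: "'i \<Rightarrow> real ^ 'n"
  assumes C: "convex C" "uminus ` C = C" "cball 0 1 \<subseteq> C"
    and u: "\<And>k. k \<in> K \<Longrightarrow> u k \<in> cball 0 1 \<inter> frontier C"
    and l: "\<And>k. k \<in> K \<Longrightarrow> 0 < l k" and "finite K"
    and id: "mat 1 = (\<Sum>k\<in>K. l k *\<^sub>R outer_prod (u k) (u k))"
    and F: "ellipsoid F" "F \<subseteq> C" "F \<noteq> cball 0 1"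
  shows "measure lebesgue F < measure lebesgue (cball 0 1 :: (real ^ 'n) set)"
proof -
  obtain A a where A: "sym_pos_def A" and Fdef: "F = (\<lambda>x. A *v x + a) ` cball 0 1"
    using F(1) unfolding ellipsoid_def by blast
  have bound: "u k \<bullet> (A *v u k) + \<bar>a \<bullet> u k\<bar> \<le> 1" if k: "k \<in> K" for k
  proof -
    \<comment> \<open>By central symmetry both \<open>A u + a\<close> and \<open>A u - a\<close> lie
      in \<open>C\<close>, where \<open>u = u k\<close>; the support inequality for the two points
      produces the absolute value.\<close>
    have "A *v u k + a \<in> C" "A *v (- u k) + a \<in> C"
      using F(2) Fdef u[OF k] by auto
    then have "A *v u k + a \<in> C" "- (A *v (- u k) + a) \<in> C"
      using C(2) by (auto simp del: minus_add_distrib)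
    from this[THEN inner_contact_point_le[OF C(1,3) u[OF k]]] show ?thesis
      by (simp add: inner_add inner_diff inner_commute vec.neg)
  qed
  have trace_sum: "trace M = (\<Sum>k\<in>K. l k * (u k \<bullet> (M *v u k)))" for M :: "real ^ 'n ^ 'n"
    unfolding inner_mat_1[symmetric] id
    by (simp add: inner_sum_right inner_outer_prod)
  have sum_l: "real CARD('n) = (\<Sum>k\<in>K. l k)"
  proof -
    have "real CARD('n) = (\<Sum>k\<in>K. l k * (u k \<bullet> u k))"
      using trace_sum[of "mat 1"] by (simp add: trace_I)
    also have "\<dots> = (\<Sum>k\<in>K. l k)"
      using norm_contact_point[OF C(3) u] by (intro sum.cong) (auto simp: norm_eq_1)
    finally show ?thesis .
  qed
  have le: "trace A + (\<Sum>k\<in>K. l k * \<bar>a \<bullet> u k\<bar>) \<le> real CARD('n)"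
    unfolding sum_l trace_sum[of A] sum.distrib[symmetric]
    by (intro sum_mono) (use bound l in \<open>simp add: mult_left_le flip: distrib_left\<close>)
  have nonneg: "0 \<le> (\<Sum>k\<in>K. l k * \<bar>a \<bullet> u k\<bar>)"
    using l by (intro sum_nonneg) (simp add: less_imp_le)
  have "A \<noteq> mat 1"
  proof
    assume "A = mat 1"
    with le have "(\<Sum>k\<in>K. l k * \<bar>a \<bullet> u k\<bar>) \<le> 0"
      by (simp add: trace_I)
    with nonneg have "(\<Sum>k\<in>K. l k * \<bar>a \<bullet> u k\<bar>) = 0" by simp
    then have 0: "a \<bullet> u k = 0" if "k \<in> K" for k
      using l that \<open>finite K\<close> by (subst (asm) sum_nonneg_eq_0_iff) (auto simp: less_imp_le, force)
    \<comment> \<open>The decomposition expands \<open>a\<close> in the \<open>u k\<close> with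
      coefficients proportional to \<open>u k \<bullet> a\<close>, all of which vanish.\<close>
    have "a = mat 1 *v a" by simp
    also have "\<dots> = (\<Sum>k\<in>K. (l k * (u k \<bullet> a)) *\<^sub>R u k)"
      unfolding id by (rule sum_outer_prod_vector_mult)
    also have "\<dots> = 0"
      using 0 by (simp add: inner_commute)
    finally have "F = cball 0 1"
      using Fdef \<open>A = mat 1\<close> by simp
    with F(3) show False ..
  qed
  moreover have "trace A \<le> real CARD('n)"
    using le nonneg by simp
  ultimately have "det A < 1"
    using A by (intro det_less_one)
  with sym_pos_def_imp_det_pos[OF A] show ?thesis
    by (simp add: Fdef measure_ellipsoid content_cball_pos)
qed

text \<open>Take \<open>I - t N\<close>. For all small \<open>t > 0\<close> its determinant exceeds
  1 (the derivative at 0 is \<open>- trace N\<close>), the image of the ball stays in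
  \<open>C\<close> (by compactness), and it is positive definite (by an operator norm
  bound).\<close>

lemma larger_ellipsoid:
  fixes C :: "(real ^ 'n) set" and N :: "real ^ 'n ^ 'n"
  assumes C: "cball 0 1 \<subseteq> C" and N: "transpose N = N" "trace N < 0"
    and contact: "\<And>u. u \<in> cball 0 1 \<inter> frontier C \<Longrightarrow> 0 < u \<bullet> (N *v u)"
  shows "\<exists>A. sym_pos_def A \<and> 1 < det A \<and> (*v) A ` cball 0 1 \<subseteq> C"
proof -
  define A where "A t = mat 1 + t *\<^sub>R (- N)" for t
  have Av: "A t *v x = x - t *\<^sub>R (N *v x)" for t x
    by (simp add: A_def matrix_vector_mult_diff_rdistrib flip: scaleR_matrix_vector_assoc)
  have Nle: "norm (N *v x) \<le> onorm ((*v) N) * norm x" for x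
    by (simp add: onorm)
  have pos: "0 < 1 + onorm ((*v) N)"
    by (simp add: onorm_pos_le add_pos_nonneg)
  have "trace (- N) = - trace N"
    by (simp add: trace_def sum_negf)
  then obtain d where "0 < d" and d: "\<And>t. 0 < t \<Longrightarrow> t < d \<Longrightarrow> 1 < det (A t)"
    using DERIV_pos_inc_right[OF has_real_derivative_det_mat_1[of "- N"]] N(2)
    by (auto simp: A_def)
  \<comment> \<open>Otherwise points \<open>x\<^sub>k\<close> of the ball with \<open>A t\<^sub>k x\<^sub>k \<notin> C\<close>, \<open>t\<^sub>k \<rightarrow> 0\<close>, accumulate at a contact point \<open>z\<close>;
      but \<open>z \<bullet> N z > 0\<close> forces \<open>\<bar>A t\<^sub>k x\<^sub>k\<bar> \<le> 1\<close>.\<close>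
  have "\<exists>e>0. \<forall>t. 0 < t \<and> t < e \<longrightarrow> (*v) (A t) ` cball 0 1 \<subseteq> C"
  proof (rule ccontr)
    assume contr: "\<not> ?thesis"
    have "\<exists>t x. 0 < t \<and> t < inverse (real (Suc k)) \<and> x \<in> cball 0 1 \<and> A t *v x \<notin> C" for k
    proof -
      have "0 < inverse (real (Suc k))" by simp
      with contr show ?thesis by blast
    qed
    then obtain t x where t: "\<And>k. 0 < t k" "\<And>k. t k < inverse (real (Suc k))"
      and x: "\<And>k. x k \<in> cball 0 1" and notin: "\<And>k. A (t k) *v x k \<notin> C"
      by metis
    have "t \<longlonglongrightarrow> 0"
      using t by (intro tendsto_sandwich[OF _ _ tendsto_const LIMSEQ_inverse_real_of_nat])
        (auto intro!: always_eventually less_imp_le)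
    have "seq_compact (cball 0 1 :: (real ^ 'n) set)"
      by (simp add: compact_imp_seq_compact)
    then obtain z r where z: "z \<in> cball 0 1" and "strict_mono r" and xr: "(x \<circ> r) \<longlonglongrightarrow> z"
      using x by (blast elim: seq_compactE)
    have tr: "(\<lambda>k. t (r k)) \<longlonglongrightarrow> 0"
      using LIMSEQ_subseq_LIMSEQ[OF \<open>t \<longlonglongrightarrow> 0\<close> \<open>strict_mono r\<close>] by (simp add: o_def)
    have Nxr: "(\<lambda>k. N *v x (r k)) \<longlonglongrightarrow> N *v z"
      using xr by (intro bounded_linear.tendsto[OF matrix_vector_mul_bounded_linear]) (simp add: o_def)
    have "(\<lambda>k. A (t (r k)) *v x (r k)) \<longlonglongrightarrow> z - 0 *\<^sub>R (N *v z)"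
      unfolding Av using xr tr Nxr by (intro tendsto_intros) (simp_all add: o_def)
    moreover have "A (t (r k)) *v x (r k) \<in> - C" for k
      using notin by simp
    ultimately have "z \<in> closure (- C)"
      unfolding closure_sequential by (intro exI[of _ "\<lambda>k. A (t (r k)) *v x (r k)"]) simp
    moreover have "z \<in> closure C"
      using z C closure_subset by blast
    ultimately have "0 < z \<bullet> (N *v z)"
      using contact z by (simp add: frontier_closures)
    \<comment> \<open>Chosen so that the squared norm of \<open>x - t (N x)\<close> is that of
      \<open>x\<close> minus \<open>t\<close> times \<open>f k\<close>; the limit of
      \<open>f\<close> is positive.\<close>
    define f where "f k = 2 * (x (r k) \<bullet> (N *v x (r k))) - t (r k) * (norm (N *v x (r k)))\<^sup>2" for k
    have "f \<longlonglongrightarrow> 2 * (z \<bullet> (N *v z)) - 0 * (norm (N *v z))\<^sup>2"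
      unfolding f_def using xr tr Nxr by (intro tendsto_intros) (simp_all add: o_def)
    then have "\<forall>\<^sub>F k in sequentially. 0 < f k"
      by (rule order_tendstoD(1)) (simp add: \<open>0 < z \<bullet> (N *v z)\<close>)
    then obtain k where "0 < f k"
      by (auto simp: eventually_sequentially)
    have "(norm (A (t (r k)) *v x (r k)))\<^sup>2 = (norm (x (r k)))\<^sup>2 - t (r k) * f k"
      unfolding Av f_def power2_norm_eq_inner
      by (simp add: inner_diff inner_commute algebra_simps)
    also have "\<dots> \<le> 1"
      using x[of "r k"] \<open>0 < f k\<close> t(1)[of "r k"]
      by (smt (verit) mem_cball_0 mult_pos_pos norm_ge_zero power_le_one)
    finally have "A (t (r k)) *v x (r k) \<in> cball 0 1"
      by (simp add: power_le_one_iff abs_square_le_1)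
    with C notin show False by blast
  qed
  then obtain e where "0 < e" and e: "\<And>t. 0 < t \<Longrightarrow> t < e \<Longrightarrow> (*v) (A t) ` cball 0 1 \<subseteq> C"
    by metis
  have "0 < min (min d e) (1 / (1 + onorm ((*v) N)))"
    using \<open>0 < d\<close> \<open>0 < e\<close> pos by simp
  then obtain t where t: "0 < t" "t < d" "t < e" "t < 1 / (1 + onorm ((*v) N))"
    using dense by (metis min_less_iff_conj)
  have "sym_pos_def (A t)"
    unfolding sym_pos_def_def
  proof (intro conjI allI impI)
    show "transpose (A t) = A t"
      using N(1) by (simp add: A_def vec_eq_iff transpose_def mat_def)
    fix y :: "real ^ 'n" assume "y \<noteq> 0"
    have "y \<bullet> (N *v y) \<le> norm y * (onorm ((*v) N) * norm y)"
      using norm_cauchy_schwarz[of y "N *v y"] Nle[of y] by (meson mult_left_mono norm_ge_zero order_trans)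
    then have "t * (y \<bullet> (N *v y)) \<le> (t * onorm ((*v) N)) * (y \<bullet> y)"
      using t(1) by (simp add: dot_square_norm power2_eq_square mult_ac)
    also have "\<dots> < 1 * (y \<bullet> y)"
      using t(1,4) pos \<open>y \<noteq> 0\<close> by (intro mult_strict_right_mono) (auto simp: field_simps)
    finally show "0 < y \<bullet> (A t *v y)"
      by (simp add: Av inner_diff)
  qed
  with t d e show ?thesis by blast
qed

section \<open>Decompositions of the identity\<close>

text \<open>The symmetric matrices are spanned by 0-1 matrices indexed by unordered index pairs:
  singletons give diagonal units, two-element sets give symmetrized off-diagonal units.\<close>

lemma dim_symmetric_matrices_le:
  "2 * dim {A :: real ^ 'n ^ 'n. transpose A = A} \<le> CARD('n) * (CARD('n) + 1)"
proof -
  define pairs where "pairs = {s :: 'n set. card s = 1} \<union> {s. card s = 2}"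
  define E :: "'n set \<Rightarrow> real ^ 'n ^ 'n" where "E s = (\<chi> i j. if {i, j} = s then 1 else 0)" for s
  have pair: "{i, j} \<in> pairs" for i j
    by (cases "i = j") (auto simp: pairs_def)
  have "A \<in> span (E ` pairs)" if A: "transpose A = A" for A
  proof -
    \<comment> \<open>The entry at an unordered pair; symmetry of \<open>A\<close> makes it
      independent of the order chosen.\<close>
    define c where "c s = (SOME a. \<exists>i j. s = {i, j} \<and> a = A $ i $ j)" for s
    have A_sym: "A $ i $ j = A $ j $ i" for i j
      using A by (metis transpose_def vec_lambda_beta)
    have c: "c {i, j} = A $ i $ j" for i j
      unfolding c_def by (rule some_equality) (auto simp: doubleton_eq_iff A_sym)
    have "A = (\<Sum>s\<in>pairs. c s *\<^sub>R E s)"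
      by (simp add: vec_eq_iff E_def pair c if_distrib cong: if_cong)
    also have "\<dots> \<in> span (E ` pairs)"
      by (intro span_sum span_scale span_base) auto
    finally show ?thesis .
  qed
  then have "dim {A :: real ^ 'n ^ 'n. transpose A = A} \<le> card (E ` pairs)"
    by (intro dim_le_card) auto
  also have "\<dots> \<le> card pairs"
    by (rule card_image_le) simp
  also have "\<dots> \<le> card {s :: 'n set. card s = 1} + card {s :: 'n set. card s = 2}"
    unfolding pairs_def by (rule card_Un_le)
  also have "\<dots> = CARD('n) + (CARD('n) choose 2)"
    using n_subsets[of "UNIV :: 'n set"] by simp
  finally have "2 * dim {A :: real ^ 'n ^ 'n. transpose A = A} \<le> 2 * CARD('n) + 2 * (CARD('n) choose 2)"
    by simp
  also have "2 * (CARD('n) choose 2) = CARD('n) * (CARD('n) - 1)"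
    by (simp add: choose_two)
  also have "2 * CARD('n) + CARD('n) * (CARD('n) - 1) = CARD('n) * (CARD('n) + 1)"
    by (cases "CARD('n)") auto
  finally show ?thesis .
qed

text \<open>Matrices \<open>outer_prod u u\<close> with \<open>u\<close> a unit vector have trace 1,
  so their affine hull misses 0 and adjoining 0 raises the dimension by one. This absorbs the
  \<open>+ 1\<close> in Caratheodory's bound.\<close>

lemma aff_dim_outer_prods_le:
  fixes T :: "(real ^ 'n) set"
  assumes "\<And>u. u \<in> T \<Longrightarrow> norm u = 1"
  shows "2 * (aff_dim ((\<lambda>u. outer_prod u u) ` T) + 1) \<le> CARD('n) * (CARD('n) + 1)"
proof -
  let ?P = "(\<lambda>u. outer_prod u u) ` T"
  have "?P \<subseteq> {M. mat 1 \<bullet> M = 1}"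
    using assms by (auto simp: inner_commute[of "mat 1"] inner_mat_1 trace_outer_prod norm_eq_1)
  then have "affine hull ?P \<subseteq> {M. mat 1 \<bullet> M = 1}"
    by (rule hull_minimal) (rule affine_hyperplane)
  then have "0 \<notin> affine hull ?P" by auto
  then have "aff_dim ?P + 1 = aff_dim (insert 0 ?P)"
    by (simp add: aff_dim_insert)
  also have "\<dots> = int (dim (insert 0 ?P))"
    by (rule aff_dim_zero) (simp add: hull_inc)
  also have "dim (insert 0 ?P) \<le> dim {A :: real ^ 'n ^ 'n. transpose A = A}"
    by (rule dim_subset) (auto simp: vec_eq_iff transpose_def outer_prod_nth)
  finally have "2 * (aff_dim ?P + 1) \<le> int (2 * dim {A :: real ^ 'n ^ 'n. transpose A = A})"
    by simp
  also have "\<dots> \<le> int (CARD('n) * (CARD('n) + 1))"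
    using dim_symmetric_matrices_le by (simp only: of_nat_le_iff)
  finally show ?thesis .
qed

lemma separating_symmetric_matrix:
  fixes T :: "(real ^ 'n) set"
  assumes "compact T" and unit: "\<And>u. u \<in> T \<Longrightarrow> norm u = 1"
    and notin: "(1 / real CARD('n)) *\<^sub>R mat 1 \<notin> convex hull (\<lambda>u. outer_prod u u) ` T"
  obtains N :: "real ^ 'n ^ 'n" where "transpose N = N" "trace N < 0"
    "\<And>u. u \<in> T \<Longrightarrow> 0 < u \<bullet> (N *v u)"
proof -
  let ?P = "(\<lambda>u. outer_prod u u) ` T"
  have "continuous_on T (\<lambda>u. outer_prod u u)"
    unfolding outer_prod_def matrix_matrix_mult_def columnvector_def rowvector_def
    by (intro continuous_intros)
  then have "compact (convex hull ?P)"
    using \<open>compact T\<close> by (intro compact_convex_hull compact_continuous_image)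
  then have "closed (convex hull ?P)"
    by (rule compact_imp_closed)
  from separating_hyperplane_closed_point[OF convex_convex_hull this notin]
  obtain M b where M: "M \<bullet> ((1 / real CARD('n)) *\<^sub>R mat 1) < b"
    and b: "\<And>x. x \<in> convex hull ?P \<Longrightarrow> b < M \<bullet> x"
    by blast
  \<comment> \<open>Symmetrizing \<open>M\<close> changes neither its trace nor its quadratic form;
    subtracting \<open>b\<close> times the identity moves the threshold \<open>b\<close> to 0,
    because the points of \<open>T\<close> are unit vectors.\<close>
  define N where "N = (1 / 2) *\<^sub>R (M + transpose M) - b *\<^sub>R mat 1"
  show thesis
  proof
    show "transpose N = N"
      by (simp add: N_def vec_eq_iff transpose_def mat_def)
    have "trace (transpose M) = trace M"
      by (simp add: trace_def transpose_def)
    then show "trace N < 0"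
      using M by (simp add: N_def trace_sub trace_scaleR trace_add trace_I inner_mat_1 field_simps)
    fix u assume "u \<in> T"
    then have "b < M \<bullet> outer_prod u u"
      by (intro b hull_inc) simp
    moreover have "u \<bullet> (transpose M *v u) = u \<bullet> (M *v u)"
      by (metis dot_lmul_matrix inner_commute vector_transpose_matrix)
    ultimately show "0 < u \<bullet> (N *v u)"
      using unit[OF \<open>u \<in> T\<close>]
      by (simp add: N_def inner_outer_prod matrix_vector_mult_diff_rdistrib matrix_vector_mult_add_rdistrib
        inner_diff inner_add norm_eq_1 flip: scaleR_matrix_vector_assoc)
  qed
qed

text \<open>Applied to a vector \<open>x\<close>, the decomposition writes \<open>x\<close> as a
  combination of the \<open>u k\<close>, so these span the space.\<close>

lemma card_ge_of_decomposition:
  fixes u :: "'i \<Rightarrow> real ^ 'n"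
  assumes "finite K" and id: "mat 1 = (\<Sum>k\<in>K. l k *\<^sub>R outer_prod (u k) (u k))"
  shows "CARD('n) \<le> card K"
proof -
  have "x \<in> span (u ` K)" for x :: "real ^ 'n"
  proof -
    have "x = mat 1 *v x" by simp
    also have "\<dots> = (\<Sum>k\<in>K. (l k * (u k \<bullet> x)) *\<^sub>R u k)"
      unfolding id by (rule sum_outer_prod_vector_mult)
    also have "\<dots> \<in> span (u ` K)"
      by (intro span_sum span_scale span_base) auto
    finally show ?thesis .
  qed
  then have "dim (UNIV :: (real ^ 'n) set) \<le> card (u ` K)"
    using \<open>finite K\<close> by (intro dim_le_card) auto
  also have "\<dots> \<le> card K"
    using \<open>finite K\<close> by (rule card_image_le)
  finally show ?thesis by simp
qed

lemma decomposition_of_convex_hull: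
  fixes T :: "(real ^ 'n) set"
  assumes unit: "\<And>u. u \<in> T \<Longrightarrow> norm u = 1"
    and hull: "(1 / real CARD('n)) *\<^sub>R mat 1 \<in> convex hull (\<lambda>u. outer_prod u u) ` T"
  obtains n :: nat and u :: "nat \<Rightarrow> real ^ 'n" and l :: "nat \<Rightarrow> real"
  where "2 * n \<le> CARD('n) * (CARD('n) + 1)" "\<forall>k\<in>{1..n}. u k \<in> T \<and> 0 < l k"
    "mat 1 = (\<Sum>k=1..n. l k *\<^sub>R outer_prod (u k) (u k))"
proof -
  let ?P = "(\<lambda>u. outer_prod u u) ` T"
  obtain S c where S: "finite S" "S \<subseteq> ?P" "card S \<le> aff_dim ?P + 1"
    and c: "\<And>M. M \<in> S \<Longrightarrow> 0 \<le> c M" and sum: "(\<Sum>M\<in>S. c M *\<^sub>R M) = (1 / real CARD('n)) *\<^sub>R mat 1"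
    using hull unfolding convex_hull_caratheodory_aff_dim by blast
  \<comment> \<open>Caratheodory yields nonnegative coefficients; discarding the zero ones makes the
    weights strictly positive without changing the sum.\<close>
  define S' where "S' = {M\<in>S. c M \<noteq> 0}"
  have "finite S'" "S' \<subseteq> S"
    using S(1) by (auto simp: S'_def)
  then have "int (card S') \<le> aff_dim ?P + 1"
    using S card_mono by (meson of_nat_mono order_trans)
  then have "int (2 * card S') \<le> int (CARD('n) * (CARD('n) + 1))"
    using aff_dim_outer_prods_le[OF unit] by fastforce
  then have card: "2 * card S' \<le> CARD('n) * (CARD('n) + 1)"
    by (simp only: of_nat_le_iff)
  obtain h where h: "bij_betw h {1..card S'} S'"
    using ex_bij_betw_nat_finite_1[OF \<open>finite S'\<close>] by blast
  have "\<forall>M\<in>S'. \<exists>u\<in>T. M = outer_prod u u"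
    using S(2) \<open>S' \<subseteq> S\<close> by blast
  then obtain w where w: "\<And>M. M \<in> S' \<Longrightarrow> w M \<in> T" "\<And>M. M \<in> S' \<Longrightarrow> outer_prod (w M) (w M) = M"
    by metis
  have hS: "h k \<in> S'" if "k \<in> {1..card S'}" for k
    using h that by (auto simp: bij_betw_def)
  show thesis
  proof
    show "2 * card S' \<le> CARD('n) * (CARD('n) + 1)" by (rule card)
    have "w (h k) \<in> T \<and> 0 < real CARD('n) * c (h k)" if "k \<in> {1..card S'}" for k
      using w(1) hS[OF that] c[of "h k"] by (auto simp: S'_def less_le)
    then show "\<forall>k\<in>{1..card S'}. w (h k) \<in> T \<and> 0 < real CARD('n) * c (h k)" ..
    have "(\<Sum>k=1..card S'. (real CARD('n) * c (h k)) *\<^sub>R outer_prod (w (h k)) (w (h k)))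
        = (\<Sum>k=1..card S'. (real CARD('n) * c (h k)) *\<^sub>R h k)"
      using w(2) hS by (intro sum.cong) auto
    also have "\<dots> = (\<Sum>M\<in>S'. (real CARD('n) * c M) *\<^sub>R M)"
      by (rule sum.reindex_bij_betw[OF h])
    also have "\<dots> = (\<Sum>M\<in>S. (real CARD('n) * c M) *\<^sub>R M)"
      using S(1) by (intro sum.mono_neutral_left) (auto simp: S'_def)
    also have "\<dots> = real CARD('n) *\<^sub>R (\<Sum>M\<in>S. c M *\<^sub>R M)"
      by (simp add: scaleR_sum_right)
    also have "\<dots> = mat 1"
      by (simp add: sum)
    finally show "mat 1 = (\<Sum>k=1..card S'. (real CARD('n) * c (h k)) *\<^sub>R outer_prod (w (h k)) (w (h k)))"
      by simp
  qed
qed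

section \<open>Equivalence of unique maximality and decomposition of the identity\<close>

theorem theorem1:
  fixes C :: "(real ^ 'd) set"
  assumes "compact C"
    and "convex C"
    and "uminus ` C = C"
    and "cball 0 1 \<subseteq> C"
  shows "unique_max_volume_ellipsoid_in C (cball 0 1) \<longleftrightarrow>
    (\<exists>(n::nat) (u :: nat \<Rightarrow> real ^ 'd) (l :: nat \<Rightarrow> real).
       CARD('d) \<le> n \<and>
       real n \<le> 1 / 2 * real CARD('d) * (real CARD('d) + 1) \<and>
       (\<forall>k\<in>{1..n}. u k \<in> cball 0 1 \<inter> frontier C \<and> l k > 0) \<and>
       mat 1 = (\<Sum>k=1..n. l k *\<^sub>R outer_prod (u k) (u k)))"
    (is "?unique \<longleftrightarrow> ?decomposition")
proof
  assume ?unique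
  then have max: "measure lebesgue F \<le> measure lebesgue (cball 0 1 :: (real ^ 'd) set)"
    if "ellipsoid F" "F \<subseteq> C" for F
    using that unfolding unique_max_volume_ellipsoid_in_def max_volume_ellipsoid_in_def by blast
  let ?T = "cball 0 1 \<inter> frontier C"
  have unit: "norm u = 1" if "u \<in> ?T" for u
    using norm_contact_point[OF assms(4) that] .
  \<comment> \<open>The factor \<open>1 / d\<close> is forced by the trace: every matrix in this
    hull has trace 1.\<close>
  have "(1 / real CARD('d)) *\<^sub>R mat 1 \<in> convex hull (\<lambda>u. outer_prod u u) ` ?T"
  proof (rule ccontr)
    assume notin: "\<not> ?thesis"
    have "compact ?T"
      by (simp add: compact_Int_closed)
    then obtain N where "transpose N = N" "trace N < 0" "\<And>u. u \<in> ?T \<Longrightarrow> 0 < u \<bullet> (N *v u)"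
      using separating_symmetric_matrix[OF _ unit notin] by blast
    then obtain A where A: "sym_pos_def A" "1 < det A" "(*v) A ` cball 0 1 \<subseteq> C"
      using larger_ellipsoid[OF assms(4)] by blast
    then have "ellipsoid ((\<lambda>x. A *v x + 0) ` cball 0 1)"
      unfolding ellipsoid_def by blast
    then have "measure lebesgue ((\<lambda>x. A *v x + 0) ` cball 0 1) \<le> measure lebesgue (cball 0 1 :: (real ^ 'd) set)"
      using A(3) by (intro max) simp_all
    then show False
      unfolding measure_ellipsoid using A(2) by (simp add: mult_le_cancel_right1 flip: not_less)
  qed
  then obtain n u l where n: "2 * n \<le> CARD('d) * (CARD('d) + 1)"
    and u: "\<forall>k\<in>{1..n}. u k \<in> ?T \<and> 0 < l k"
    and id: "mat 1 = (\<Sum>k=1..n. l k *\<^sub>R outer_prod (u k) (u k))"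
    using decomposition_of_convex_hull[of ?T, OF unit] by blast
  have "CARD('d) \<le> n"
    using card_ge_of_decomposition[OF _ id] by simp
  moreover have "real n \<le> 1 / 2 * real CARD('d) * (real CARD('d) + 1)"
  proof -
    have "real (2 * n) \<le> real (CARD('d) * (CARD('d) + 1))"
      using n by (simp only: of_nat_le_iff)
    then show ?thesis by (simp add: algebra_simps)
  qed
  ultimately show ?decomposition
    using u id by blast
next
  assume ?decomposition
  then obtain n :: nat and u l where u: "\<forall>k\<in>{1..n}. u k \<in> cball 0 1 \<inter> frontier C \<and> 0 < l k"
    and id: "mat 1 = (\<Sum>k=1..n. l k *\<^sub>R outer_prod (u k) (u k))"
    by blast
  have less: "measure lebesgue F < measure lebesgue (cball 0 1 :: (real ^ 'd) set)"
    if "ellipsoid F" "F \<subseteq> C" "F \<noteq> cball 0 1" for F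
    using u by (intro measure_ellipsoid_less_unit_ball[OF assms(2-4) _ _ _ id that]) auto
  then have "max_volume_ellipsoid_in C (cball 0 1)"
    using assms(4) ellipsoid_unit_ball unfolding max_volume_ellipsoid_in_def
    by (metis less_imp_le order_refl)
  moreover have "F = cball 0 1" if "max_volume_ellipsoid_in C F" for F
    using that less assms(4) ellipsoid_unit_ball unfolding max_volume_ellipsoid_in_def
    by (metis not_less)
  ultimately show ?unique
    unfolding unique_max_volume_ellipsoid_in_def by blast
qed

end
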